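(* Let $G=(V,A)$ be a two-way directed graph with centroid set $B\subseteq V$ and known turning factors $\alpha$, and let $M\subseteq V$ be a set of monitored vertices. If the flow on all arcs of $G$ and the balancing flows at all vertices of $B$ are uniquely determined (by the monitored information, the turning factors and flow conservation), then there exists a set $\mathcal{P}$ of $|B\setminus M|$ pairwise vertex-disjoint $B$-paths.
   Context: A two-way directed graph is a finite directed graph $G=(V,A)$ without loops or parallel arcs such that $uv\in A$ implies $vu\in A$. Every vertex is assumed to have at least one outgoing arc. A set $B\subseteq V$ of centroids is given. A flow with balancing flows is a pair $(f,S)$ with $f:A\to\mathbb{R}$, $S:V\to\mathbb{R}$, $S_v=0$ for $v\notin B$ ($S_v$ is an unknown real number for $v\in B$), satisfying flow conservation at every $v\in V$: $$\sum_{e \text{ with head } v} f_e-\sum_{e\text{ with tail } v} f_e+S_v=0 .$$ Turning factors: each arc $vu$ has a known positive turning ratio $c_{vu}$. For each vertex $v$ a canonical outgoing arc $e_v=vw$ is fixed and $\alpha_{vu}=c_{vu}/c_{vw}>0$ for every outgoing arc $vu$ (so $\alpha_{e_v}=1$). The flow is required to satisfy $f_{vu}=\alpha_{vu}f_{e_v}$ for every arc $vu\in A$. This is the only way turning ratios enter the system. Monitoring $M\subseteq V$ reveals the values of $f$ on all arcs entering or leaving vertices of $M$, and the values $S_m$ for $m\in M$. The flow and balancing flows are uniquely determined if any two pairs $(f,S)$, $(f',S')$, each satisfying flow conservation at every vertex of $V$, zero balancing flow at every vertex of $V\setminus B$, and the turning-factor equations ($f_{vu}=\alpha_{vu}f_{e_v}$,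 respectively $f'_{vu}=\alpha_{vu}f'_{e_v}$, for every arc $vu\in A$), for the same $G,B,\alpha$, that agree on all arcs incident to $M$ and on the balancing flows at $M$ are equal. $A(M)$ denotes the set of vertices in $V\setminus M$ adjacent to at least one vertex of $M$. A $B$-path is a path in $G$ starting at a centroid in $B\setminus M$ and ending at a vertex of $A(M)$; a path consisting of a single vertex is allowed. *)

theory Defs
  imports Complex_Main "Graph_Theory.Digraph" "Graph_Theory.Vertex_Walk"
begin

text \<open>The locale \<open>graph\<close> of Graph-Theory is the locale of finite symmetric digraphs without
  loops or parallel arcs.\<close>

locale two_way_digraph = Digraph.graph G
  for G :: "('v, 'e) pre_digraph" (structure) +
  assumes out_arcs_nonempty: "v \<in> verts G \<Longrightarrow> out_arcs G v \<noteq> {}"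

text \<open>\<open>c\<close> gives the turning ratios and \<open>e\<close> the canonical outgoing arc of each vertex.\<close>

definition turning_factor ::
    "('v, 'e) pre_digraph \<Rightarrow> ('e \<Rightarrow> real) \<Rightarrow> ('v \<Rightarrow> 'e) \<Rightarrow> 'e \<Rightarrow> real" where
  "turning_factor G c e a = c a / c (e (tail G a))"

definition flow_conservation ::
    "('v, 'e) pre_digraph \<Rightarrow> ('e \<Rightarrow> real) \<Rightarrow> ('v \<Rightarrow> real) \<Rightarrow> bool" where
  "flow_conservation G f S \<longleftrightarrow>
     (\<forall>v \<in> verts G. (\<Sum>a \<in> in_arcs G v. f a) - (\<Sum>a \<in> out_arcs G v. f a) + S v = 0)"

text \<open>\<open>f\<close> and \<open>S\<close> are total functions; only their values on \<open>arcs G\<close> and \<open>verts G\<close> are meaningful.\<close>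

definition admissible_flow ::
    "('v, 'e) pre_digraph \<Rightarrow> 'v set \<Rightarrow> ('e \<Rightarrow> real) \<Rightarrow> ('v \<Rightarrow> 'e) \<Rightarrow>
     ('e \<Rightarrow> real) \<Rightarrow> ('v \<Rightarrow> real) \<Rightarrow> bool" where
  "admissible_flow G B \<alpha> e f S \<longleftrightarrow>
     flow_conservation G f S \<and>
     (\<forall>v \<in> verts G - B. S v = 0) \<and>
     (\<forall>a \<in> arcs G. f a = \<alpha> a * f (e (tail G a)))"

definition same_observations ::
    "('v, 'e) pre_digraph \<Rightarrow> 'v set \<Rightarrow> ('e \<Rightarrow> real) \<Rightarrow> ('v \<Rightarrow> real) \<Rightarrow>
     ('e \<Rightarrow> real) \<Rightarrow> ('v \<Rightarrow> real) \<Rightarrow> bool" where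
  "same_observations G M f S f' S' \<longleftrightarrow>
     (\<forall>m \<in> M. (\<forall>a \<in> in_arcs G m \<union> out_arcs G m. f a = f' a) \<and> S m = S' m)"

definition uniquely_determined ::
    "('v, 'e) pre_digraph \<Rightarrow> 'v set \<Rightarrow> ('e \<Rightarrow> real) \<Rightarrow> ('v \<Rightarrow> 'e) \<Rightarrow> 'v set \<Rightarrow> bool" where
  "uniquely_determined G B \<alpha> e M \<longleftrightarrow>
     (\<forall>f S f' S'.
        admissible_flow G B \<alpha> e f S \<longrightarrow>
        admissible_flow G B \<alpha> e f' S' \<longrightarrow>
        same_observations G M f S f' S' \<longrightarrow>
        (\<forall>a \<in> arcs G. f a = f' a) \<and> (\<forall>v \<in> verts G. S v = S' v))"

definition adjacent_set :: "('v, 'e) pre_digraph \<Rightarrow> 'v set \<Rightarrow> 'v set" where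
  "adjacent_set G M = {v \<in> verts G - M. \<exists>m \<in> M. v \<rightarrow>\<^bsub>G\<^esub> m \<or> m \<rightarrow>\<^bsub>G\<^esub> v}"

text \<open>Paths are nonempty lists of distinct vertices, so \<open>[v]\<close> is the one-vertex path at \<open>v\<close>.\<close>

definition B_path :: "('v, 'e) pre_digraph \<Rightarrow> 'v set \<Rightarrow> 'v set \<Rightarrow> 'v list \<Rightarrow> bool" where
  "B_path G B M p \<longleftrightarrow> vpath p G \<and> hd p \<in> B - M \<and> last p \<in> adjacent_set G M"

definition vertex_disjoint :: "'v list set \<Rightarrow> bool" where
  "vertex_disjoint P \<longleftrightarrow> pairwise (\<lambda>p q. disjnt (set p) (set q)) P"

end

theory Submission
  imports Defs
begin

text \<open>
  Only the flows \<open>x v\<close> on the canonical arcs matter, and monitoring forces \<open>x = 0\<close> on \<open>M \<union> A(M)\<close>.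
  Conservation at \<open>v \<in> B\<close> merely defines \<open>S v\<close>, so unique determination says that the matrix with
  columns \<open>W = V - (M \<union> A(M))\<close> and rows \<open>V - (B \<union> M)\<close> has trivial kernel. Such a matrix has a
  transversal of nonzero entries, that is, an injection \<open>\<sigma>\<close> from \<open>W\<close> into \<open>V - (B \<union> M)\<close> for which
  \<open>\<sigma> u\<close> is \<open>u\<close> or an out-neighbour of \<open>u\<close>. No vertex of \<open>B\<close> is a value of \<open>\<sigma>\<close>, so the orbits under
  \<open>\<sigma>\<close> of the vertices of \<open>B - M\<close> never close up; they run through \<open>W\<close> until they reach \<open>A(M)\<close>, and
  injectivity makes them pairwise disjoint paths.
\<close>

section \<open>Transversals of matrices with trivial kernel\<close>

text \<open>Induction on the columns, as in a Laplace expansion but without determinants: for a new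
  column \<open>j\<close> some row \<open>i\<close> with \<open>A i j \<noteq> 0\<close> can be
  deleted together with \<open>j\<close> so that the kernel stays trivial, and \<open>i\<close>
  becomes the value at \<open>j\<close>.\<close>

lemma trivial_kernel_imp_transversal:
  fixes A :: "'i \<Rightarrow> 'j \<Rightarrow> 'a::field"
  assumes "finite J" and "finite I"
    and "\<And>x. (\<And>i. i \<in> I \<Longrightarrow> (\<Sum>j\<in>J. A i j * x j) = 0) \<Longrightarrow> (\<And>j. j \<in> J \<Longrightarrow> x j = 0)"
  shows "\<exists>\<sigma>. inj_on \<sigma> J \<and> (\<forall>j\<in>J. \<sigma> j \<in> I \<and> A (\<sigma> j) j \<noteq> 0)"
  using assms
proof (induction J arbitrary: I rule: finite_induct)
  case empty
  then show ?case by simp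
next
  case (insert j J)
  note ker = insert.prems(2)
  have "\<exists>i\<in>I. A i j \<noteq> 0 \<and>
    (\<forall>x. (\<forall>k\<in>I - {i}. (\<Sum>l\<in>J. A k l * x l) = 0) \<longrightarrow> (\<forall>l\<in>J. x l = 0))"
  proof (rule ccontr)
    text \<open>Otherwise every unit vector \<open>i\<close> with \<open>A i j \<noteq> 0\<close> lies in the span of the columns \<open>J\<close>,
      hence so does column \<open>j\<close>.\<close>
    define N where "N = {i\<in>I. A i j \<noteq> 0}"
    assume "\<not> ?thesis"
    then have "\<forall>i\<in>N. \<exists>x. (\<forall>k\<in>I - {i}. (\<Sum>l\<in>J. A k l * x l) = 0) \<and> (\<exists>l\<in>J. x l \<noteq> 0)"
      unfolding N_def by blast
    from bchoice[OF this] obtain y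
      where y: "\<forall>i\<in>N. (\<forall>k\<in>I - {i}. (\<Sum>l\<in>J. A k l * y i l) = 0) \<and> (\<exists>l\<in>J. y i l \<noteq> 0)" ..
    have y0: "(\<Sum>l\<in>J. A k l * y i l) = 0" if "i \<in> N" "k \<in> I - {i}" for i k
      using y that by blast
    have ynz: "\<exists>l\<in>J. y i l \<noteq> 0" if "i \<in> N" for i
      using y that by blast
    \<comment> \<open>By \<open>y0\<close> the columns \<open>J\<close> map \<open>y i\<close> to
      \<open>s i\<close> times the unit vector \<open>i\<close>. If \<open>s i\<close> were 0, then
      \<open>y i\<close> extended by 0 at \<open>j\<close> would be a nonzero kernel vector of the
      full matrix.\<close>
    define s where "s i = (\<Sum>l\<in>J. A i l * y i l)" for i
    have s: "s i \<noteq> 0" if i: "i \<in> N" for i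
    proof
      assume "s i = 0"
      have "(\<Sum>l\<in>insert j J. A k l * ((y i)(j := 0)) l) = 0" if "k \<in> I" for k
      proof -
        have "(\<Sum>l\<in>insert j J. A k l * ((y i)(j := 0)) l) = (\<Sum>l\<in>J. A k l * y i l)"
          using insert.hyps by (auto intro!: sum.cong)
        also have "\<dots> = 0"
          using \<open>s i = 0\<close> y0[OF i, of k] that unfolding s_def by (cases "k = i") auto
        finally show ?thesis .
      qed
      then have y': "((y i)(j := 0)) l = 0" if "l \<in> J" for l
        using ker[of "(y i)(j := 0)" l] that by blast
      have "y i l = 0" if "l \<in> J" for l
      proof -
        have "l \<noteq> j" using that insert.hyps by blast
        with y'[OF that] show ?thesis by simp
      qed
      then show False
        using ynz[OF i] by blast
    qed
    \<comment> \<open>Column \<open>j\<close> is the sum over \<open>i\<close> in \<open>N\<close>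
      of \<open>A i j\<close> times the unit vector \<open>i\<close>, and that unit vector is the
      image of \<open>y i\<close> divided by \<open>s i\<close>. Hence \<open>z\<close> encodes
      column \<open>j\<close> minus its expansion in the columns \<open>J\<close>.\<close>
    define z where "z l = (if l = j then 1 else - (\<Sum>i\<in>N. A i j / s i * y i l))" for l
    have "(\<Sum>l\<in>insert j J. A k l * z l) = 0" if k: "k \<in> I" for k
    proof -
      have fin: "finite N" using insert.prems(1) by (simp add: N_def)
      have "(\<Sum>l\<in>J. A k l * z l) = (\<Sum>l\<in>J. A k l * - (\<Sum>i\<in>N. A i j / s i * y i l))"
        using insert.hyps by (intro sum.cong) (auto simp: z_def)
      also have "\<dots> = - (\<Sum>l\<in>J. \<Sum>i\<in>N. A i j / s i * (A k l * y i l))"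
        by (simp add: sum_distrib_left sum_negf mult_ac)
      also have "\<dots> = - (\<Sum>i\<in>N. A i j / s i * (\<Sum>l\<in>J. A k l * y i l))"
        by (subst sum.swap) (simp add: sum_distrib_left)
      \<comment> \<open>Only the summand \<open>i = k\<close> survives. If \<open>k\<close> is not
        in \<open>N\<close>, there is none, but then \<open>A k j\<close> is 0 too.\<close>
      also have "(\<Sum>i\<in>N. A i j / s i * (\<Sum>l\<in>J. A k l * y i l)) =
          (\<Sum>i\<in>N. if i = k then A k j else 0)"
        using y0 k s by (intro sum.cong) (auto simp: s_def)
      also have "\<dots> = A k j"
        using fin k by (simp add: N_def)
      finally show ?thesis
        using insert.hyps by (simp add: z_def)
    qed
    then have "z j = 0" using ker[of z j] by blast
    then show False by (simp add: z_def)
  qed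
  then obtain i where i: "i \<in> I" "A i j \<noteq> 0"
    and "\<And>x l. (\<And>k. k \<in> I - {i} \<Longrightarrow> (\<Sum>l\<in>J. A k l * x l) = 0) \<Longrightarrow> l \<in> J \<Longrightarrow> x l = 0"
    by blast
  then obtain \<sigma> where \<sigma>: "inj_on \<sigma> J" "\<forall>l\<in>J. \<sigma> l \<in> I - {i} \<and> A (\<sigma> l) l \<noteq> 0"
    using insert.IH[of "I - {i}"] insert.prems(1) by blast
  have "inj_on (\<sigma>(j := i)) J"
    using \<sigma> by (intro inj_on_fun_updI) auto
  then have "inj_on (\<sigma>(j := i)) (insert j J)"
    using \<sigma>(2) insert.hyps by auto
  moreover have "\<forall>l\<in>insert j J. (\<sigma>(j := i)) l \<in> I \<and> A ((\<sigma>(j := i)) l) l \<noteq> 0"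
    using \<sigma> i by auto
  ultimately show ?case by blast
qed

section \<open>Orbits of an injection as disjoint paths\<close>

text \<open>Injectivity cancels one application of \<open>\<sigma>\<close> on both sides until an
  exponent is 0; if the other is not, a starting point would lie in the image of
  \<open>\<sigma>\<close>. The case \<open>b = b'\<close> says that an orbit does not
  repeat.\<close>

lemma funpow_orbits_disjoint:
  assumes "inj_on \<sigma> W" and "b \<notin> \<sigma> ` W" and "b' \<notin> \<sigma> ` W"
    and "(\<sigma> ^^ k) b = (\<sigma> ^^ l) b'"
    and "\<And>i. i < k \<Longrightarrow> (\<sigma> ^^ i) b \<in> W" and "\<And>i. i < l \<Longrightarrow> (\<sigma> ^^ i) b' \<in> W"
  shows "k = l \<and> b = b'"
  using assms(4-)
proof (induction k arbitrary: l)
  case 0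
  show ?case
  proof (cases l)
    case (Suc l')
    then have "b = \<sigma> ((\<sigma> ^^ l') b')" "(\<sigma> ^^ l') b' \<in> W" using 0 by auto
    then show ?thesis using assms(2) by blast
  qed (use 0 in auto)
next
  case (Suc k)
  have k: "(\<sigma> ^^ k) b \<in> W" using Suc.prems by auto
  show ?case
  proof (cases l)
    case 0
    then have "b' = \<sigma> ((\<sigma> ^^ k) b)" using Suc.prems by auto
    then show ?thesis using assms(3) k by blast
  next
    case (Suc l')
    then have "(\<sigma> ^^ l') b' \<in> W" using Suc.prems by auto
    then have "(\<sigma> ^^ k) b = (\<sigma> ^^ l') b'"
      using Suc.prems(1) Suc k inj_onD[OF assms(1)] by auto
    then have "k = l' \<and> b = b'"
      using Suc.prems Suc by (intro Suc.IH) auto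
    then show ?thesis using Suc by simp
  qed
qed

lemma funpow_orbit_leaves:
  assumes "finite W" and "inj_on \<sigma> W" and "b \<notin> \<sigma> ` W"
  obtains n where "(\<sigma> ^^ n) b \<notin> W" and "\<And>i. i < n \<Longrightarrow> (\<sigma> ^^ i) b \<in> W"
proof -
  have "\<exists>n. (\<sigma> ^^ n) b \<notin> W"
  proof (rule ccontr)
    assume "\<not> ?thesis"
    then have W: "(\<sigma> ^^ n) b \<in> W" for n by blast
    have "inj (\<lambda>n. (\<sigma> ^^ n) b)"
      using funpow_orbits_disjoint[OF assms(2,3,3)] W by (intro injI) blast
    moreover have "finite (range (\<lambda>n. (\<sigma> ^^ n) b))"
      using W by (intro finite_subset[OF _ assms(1)]) blast
    ultimately show False using finite_imageD by blast
  qed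
  then obtain n where "(\<sigma> ^^ n) b \<notin> W" "\<forall>i<n. \<not> (\<sigma> ^^ i) b \<notin> W"
    using exists_least_iff[of "\<lambda>n. (\<sigma> ^^ n) b \<notin> W"] by blast
  then show thesis using that by blast
qed

lemma vwalk_map_upt:
  assumes "\<And>i. i \<le> n \<Longrightarrow> g i \<in> verts G"
    and "\<And>i. i < n \<Longrightarrow> g i \<rightarrow>\<^bsub>G\<^esub> g (Suc i)"
  shows "vwalk (map g [0..<Suc n]) G"
  using assms
proof (induction n)
  case 0
  then show ?case by (auto simp: vwalk_def)
next
  case (Suc n)
  then have "vwalk (map g [0..<Suc n]) G" by simp
  moreover have "set (vwalk_arcs (map g [0..<Suc n] @ [g (Suc n)])) =
      insert (g n, g (Suc n)) (set (vwalk_arcs (map g [0..<Suc n])))"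
    using set_vwalk_arcs_snoc[of "map g [0..<Suc n]" "g (Suc n)"] by simp
  ultimately show ?case
    using Suc.prems(1)[of "Suc n"] Suc.prems(2)[of n] by (auto simp: vwalk_def)
qed

text \<open>Each path is the orbit of \<open>b\<close> up to its first exit from \<open>W\<close>,
  which can only lead into \<open>T\<close>. The single fact \<open>eq\<close> yields both
  distinctness within a path and disjointness of different paths.\<close>

lemma disjoint_paths_of_injection:
  assumes "finite W" and "inj_on \<sigma> W" and "D \<inter> \<sigma> ` W = {}"
    and "D \<subseteq> W \<union> T" and "\<sigma> ` W \<subseteq> W \<union> T" and "W \<union> T \<subseteq> verts G"
    and arc: "\<And>u. u \<in> W \<Longrightarrow> \<sigma> u \<noteq> u \<Longrightarrow> u \<rightarrow>\<^bsub>G\<^esub> \<sigma> u"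
  obtains p where "\<And>b. b \<in> D \<Longrightarrow> vpath (p b) G \<and> hd (p b) = b \<and> last (p b) \<in> T"
    and "\<And>b b'. b \<in> D \<Longrightarrow> b' \<in> D \<Longrightarrow> b \<noteq> b' \<Longrightarrow> disjnt (set (p b)) (set (p b'))"
proof -
  have D: "b \<notin> \<sigma> ` W" if "b \<in> D" for b using assms(3) that by blast
  have "\<forall>b\<in>D. \<exists>n. (\<sigma> ^^ n) b \<notin> W \<and> (\<forall>i<n. (\<sigma> ^^ i) b \<in> W)"
  proof
    fix b assume "b \<in> D"
    from funpow_orbit_leaves[OF assms(1,2) D[OF this]]
    show "\<exists>n. (\<sigma> ^^ n) b \<notin> W \<and> (\<forall>i<n. (\<sigma> ^^ i) b \<in> W)" by blast
  qed
  from bchoice[OF this] obtain n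
    where n_all: "\<forall>b\<in>D. (\<sigma> ^^ n b) b \<notin> W \<and> (\<forall>i<n b. (\<sigma> ^^ i) b \<in> W)" ..
  have n: "(\<sigma> ^^ n b) b \<notin> W" if "b \<in> D" for b
    using n_all that by blast
  have nW: "(\<sigma> ^^ i) b \<in> W" if "b \<in> D" "i < n b" for b i
    using n_all that by blast
  \<comment> \<open>The exit vertex is included, so \<open>n b = 0\<close> gives the one-vertex path
    at \<open>b\<close>.\<close>
  define p where "p b = map (\<lambda>k. (\<sigma> ^^ k) b) [0..<Suc (n b)]" for b
  have eq: "k = l \<and> b = b'"
    if "b \<in> D" "b' \<in> D" "(\<sigma> ^^ k) b = (\<sigma> ^^ l) b'" "k \<le> n b" "l \<le> n b'" for b b' k l
    by (rule funpow_orbits_disjoint[OF assms(2) D[OF that(1)] D[OF that(2)] that(3)])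
      (use that nW in auto)
  have WT: "(\<sigma> ^^ k) b \<in> W \<union> T" if b: "b \<in> D" "k \<le> n b" for b k
  proof (cases k)
    case 0
    then show ?thesis using assms(4) b by auto
  next
    case (Suc k')
    then show ?thesis using nW[of b k'] b assms(5) by auto
  qed
  show thesis
  proof
    fix b assume b: "b \<in> D"
    have "vwalk (p b) G"
      unfolding p_def
    proof (rule vwalk_map_upt)
      show "(\<sigma> ^^ i) b \<in> verts G" if "i \<le> n b" for i
        using WT[OF b that] assms(6) by blast
      \<comment> \<open>Fixed points of \<open>\<sigma>\<close> are possible, but \<open>eq\<close>
        with exponents \<open>Suc i\<close> and \<open>i\<close> keeps them off this orbit.\<close>
      show "(\<sigma> ^^ i) b \<rightarrow>\<^bsub>G\<^esub> (\<sigma> ^^ Suc i) b" if "i < n b" for i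
        using arc[OF nW[OF b that]] eq[OF b b, of "Suc i" i] that by auto
    qed
    moreover have "distinct (p b)"
      using eq[OF b b] by (auto simp: p_def distinct_map inj_on_def simp del: upt_Suc)
    moreover have "hd (p b) = b"
      by (simp add: p_def hd_map del: upt_Suc)
    moreover have "last (p b) \<in> T"
      using WT[OF b, of "n b"] n[OF b] by (simp add: p_def)
    ultimately show "vpath (p b) G \<and> hd (p b) = b \<and> last (p b) \<in> T" by blast
  next
    fix b b' assume b: "b \<in> D" "b' \<in> D" "b \<noteq> b'"
    then have "(\<sigma> ^^ k) b \<noteq> (\<sigma> ^^ l) b'" if "k \<le> n b" "l \<le> n b'" for k l
      using eq[OF b(1,2) _ that] by blast
    then show "disjnt (set (p b)) (set (p b'))"
      by (auto simp: p_def disjnt_iff less_Suc_eq_le simp del: upt_Suc)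
  qed
qed

section \<open>The conservation equations as a matrix\<close>

text \<open>Coefficient of the canonical flow of \<open>u\<close> in inflow minus outflow at
  \<open>v\<close>: the negative of a transposed weighted out-degree Laplacian.\<close>

definition flow_matrix :: "('v, 'e) pre_digraph \<Rightarrow> ('e \<Rightarrow> real) \<Rightarrow> 'v \<Rightarrow> 'v \<Rightarrow> real" where
  "flow_matrix G \<alpha> v u =
     (\<Sum>a\<in>{a \<in> in_arcs G v. tail G a = u}. \<alpha> a) - (if u = v then \<Sum>a\<in>out_arcs G v. \<alpha> a else 0)"

lemma flow_matrix_nonzero_imp_arc:
  assumes "flow_matrix G \<alpha> v u \<noteq> 0" and "v \<noteq> u"
  shows "u \<rightarrow>\<^bsub>G\<^esub> v"
proof -
  have "{a \<in> in_arcs G v. tail G a = u} \<noteq> {}"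
  proof
    assume empty: "{a \<in> in_arcs G v. tail G a = u} = {}"
    have "flow_matrix G \<alpha> v u = 0"
      unfolding flow_matrix_def empty using assms(2) by simp
    with assms(1) show False ..
  qed
  then obtain a where "a \<in> arcs G" "head G a = v" "tail G a = u" by auto
  then show ?thesis by (auto simp: arcs_ends_def arc_to_ends_def)
qed

lemma (in fin_digraph) flow_matrix_mult:
  assumes "U \<subseteq> verts G" and "v \<in> verts G" and "\<And>u. u \<in> verts G - U \<Longrightarrow> x u = 0"
  shows "(\<Sum>u\<in>U. flow_matrix G \<alpha> v u * x u) =
    (\<Sum>a\<in>in_arcs G v. \<alpha> a * x (tail G a)) - (\<Sum>a\<in>out_arcs G v. \<alpha> a * x (tail G a))"
proof -
  have fin: "finite (in_arcs G v)" "finite (out_arcs G v)"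
    by auto
  have "(\<Sum>u\<in>U. flow_matrix G \<alpha> v u * x u) = (\<Sum>u\<in>verts G. flow_matrix G \<alpha> v u * x u)"
    using assms by (intro sum.mono_neutral_left) auto
  also have "\<dots> = (\<Sum>u\<in>verts G. \<Sum>a\<in>{a \<in> in_arcs G v. tail G a = u}. \<alpha> a * x (tail G a)) -
      (\<Sum>u\<in>verts G. if u = v then \<Sum>a\<in>out_arcs G v. \<alpha> a * x v else 0)"
    unfolding flow_matrix_def sum_subtractf[symmetric]
    by (intro sum.cong) (auto simp: left_diff_distrib sum_distrib_right)
  also have "(\<Sum>u\<in>verts G. \<Sum>a\<in>{a \<in> in_arcs G v. tail G a = u}. \<alpha> a * x (tail G a)) =
      (\<Sum>a\<in>in_arcs G v. \<alpha> a * x (tail G a))"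
    using fin by (intro sum.group) auto
  also have "(\<Sum>u\<in>verts G. if u = v then \<Sum>a\<in>out_arcs G v. \<alpha> a * x v else 0) =
      (\<Sum>a\<in>out_arcs G v. \<alpha> a * x (tail G a))"
    using assms(2) by (auto intro!: sum.cong)
  finally show ?thesis .
qed

text \<open>A kernel vector, extended by 0 and spread over the arcs by \<open>\<alpha>\<close>, is
  an admissible flow that looks like the zero flow from \<open>M\<close>.\<close>

lemma (in fin_digraph) uniquely_determined_imp_trivial_kernel:
  assumes "M \<subseteq> verts G"
    and e: "\<And>v. v \<in> verts G \<Longrightarrow> e v \<in> out_arcs G v"
    and \<alpha>: "\<And>v. v \<in> verts G \<Longrightarrow> \<alpha> (e v) = 1"
    and uniq: "uniquely_determined G B \<alpha> e M"
    and W: "W = verts G - (M \<union> adjacent_set G M)"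
    and ker: "\<And>v. v \<in> verts G - (B \<union> M) \<Longrightarrow> (\<Sum>u\<in>W. flow_matrix G \<alpha> v u * x u) = 0"
    and "w \<in> W"
  shows "x w = 0"
proof -
  define y where "y u = (if u \<in> W then x u else 0)" for u
  define f where "f a = \<alpha> a * y (tail G a)" for a
  \<comment> \<open>Conservation holds by this choice. It remains to see that \<open>S\<close>
    vanishes outside \<open>B\<close>: on \<open>M\<close> because all incident flows are 0,
    elsewhere by \<open>ker\<close>.\<close>
  define S where "S v = (\<Sum>a\<in>out_arcs G v. f a) - (\<Sum>a\<in>in_arcs G v. f a)" for v
  have obs: "f a = 0" if "m \<in> M" "a \<in> in_arcs G m \<union> out_arcs G m" for m a
  proof -
    have "tail G a \<in> M \<union> adjacent_set G M"
      using that by (auto simp: adjacent_set_def arcs_ends_def arc_to_ends_def)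
    then show ?thesis by (simp add: f_def y_def W)
  qed
  then have SM: "S m = 0" if "m \<in> M" for m
    using that by (simp add: S_def)
  have "S v = 0" if v: "v \<in> verts G - B" for v
  proof (cases "v \<in> M")
    case False
    have "- S v = (\<Sum>u\<in>W. flow_matrix G \<alpha> v u * y u)"
      unfolding S_def f_def
      by (subst flow_matrix_mult) (use v in \<open>auto simp: W y_def\<close>)
    also have "\<dots> = (\<Sum>u\<in>W. flow_matrix G \<alpha> v u * x u)"
      by (simp add: y_def)
    also have "\<dots> = 0" using ker v False by blast
    finally show ?thesis by simp
  qed (rule SM)
  moreover have "f (e v) = y v" if "v \<in> verts G" for v
    using e[OF that] \<alpha>[OF that] by (simp add: f_def)
  ultimately have "admissible_flow G B \<alpha> e f S"
    by (simp add: admissible_flow_def flow_conservation_def S_def f_def)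
  moreover have "admissible_flow G B \<alpha> e (\<lambda>_. 0) (\<lambda>_. 0)"
    by (simp add: admissible_flow_def flow_conservation_def)
  moreover have "same_observations G M f S (\<lambda>_. 0) (\<lambda>_. 0)"
    unfolding same_observations_def using obs SM by blast
  ultimately have "\<forall>a\<in>arcs G. f a = 0"
    using uniq unfolding uniquely_determined_def by blast
  moreover have "e w \<in> arcs G" "tail G (e w) = w" "\<alpha> (e w) = 1"
    using e[of w] \<alpha>[of w] \<open>w \<in> W\<close> W by auto
  ultimately show ?thesis
    using \<open>w \<in> W\<close> by (auto simp: f_def y_def)
qed

theorem theorem5p2:
  fixes G :: "('v, 'e) pre_digraph"
    and B M :: "'v set"
    and c :: "'e \<Rightarrow> real"
    and e :: "'v \<Rightarrow> 'e"
  assumes "two_way_digraph G"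
    and "B \<subseteq> verts G"
    and "M \<subseteq> verts G"
    and "\<And>a. a \<in> arcs G \<Longrightarrow> 0 < c a"
    and "\<And>v. v \<in> verts G \<Longrightarrow> e v \<in> out_arcs G v"
    and "uniquely_determined G B (turning_factor G c e) e M"
  shows "\<exists>P. finite P \<and> card P = card (B - M) \<and> (\<forall>p \<in> P. B_path G B M p) \<and> vertex_disjoint P"
proof -
  interpret two_way_digraph G by fact
  define W where "W = verts G - (M \<union> adjacent_set G M)"
  have \<alpha>: "turning_factor G c e (e v) = 1" if "v \<in> verts G" for v
    using assms(4)[of "e v"] assms(5)[OF that] by (auto simp: turning_factor_def)
  have finW: "finite W" by (simp add: W_def)
  have "\<exists>\<sigma>. inj_on \<sigma> W \<and>
      (\<forall>u\<in>W. \<sigma> u \<in> verts G - (B \<union> M) \<and> flow_matrix G (turning_factor G c e) (\<sigma> u) u \<noteq> 0)"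
    using uniquely_determined_imp_trivial_kernel[OF assms(3,5) \<alpha> assms(6) W_def] finW
    by (intro trivial_kernel_imp_transversal) auto
  then obtain \<sigma> where \<sigma>: "inj_on \<sigma> W" "\<And>u. u \<in> W \<Longrightarrow> \<sigma> u \<in> verts G - (B \<union> M)"
    and nz: "\<And>u. u \<in> W \<Longrightarrow> flow_matrix G (turning_factor G c e) (\<sigma> u) u \<noteq> 0"
    by blast
  have arc: "u \<rightarrow>\<^bsub>G\<^esub> \<sigma> u" if "u \<in> W" "\<sigma> u \<noteq> u" for u
    using flow_matrix_nonzero_imp_arc[OF nz] that .
  have "(B - M) \<inter> \<sigma> ` W = {}" "B - M \<subseteq> W \<union> adjacent_set G M"
    "\<sigma> ` W \<subseteq> W \<union> adjacent_set G M" "W \<union> adjacent_set G M \<subseteq> verts G"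
    using \<sigma>(2) assms(2) by (auto simp: W_def adjacent_set_def)
  from disjoint_paths_of_injection[OF finW \<sigma>(1) this arc]
  obtain p where p: "\<And>b. b \<in> B - M \<Longrightarrow> vpath (p b) G \<and> hd (p b) = b \<and> last (p b) \<in> adjacent_set G M"
    and disj: "\<And>b b'. b \<in> B - M \<Longrightarrow> b' \<in> B - M \<Longrightarrow> b \<noteq> b' \<Longrightarrow> disjnt (set (p b)) (set (p b'))"
    by blast
  \<comment> \<open>The head of a path recovers its centroid, so no two centroids share a path and
    the count is exact.\<close>
  have "inj_on p (B - M)"
    using p by (intro inj_on_inverseI[of _ hd]) blast
  moreover have "finite (B - M)"
    using finite_subset[OF assms(2)] by simp
  moreover have "vertex_disjoint (p ` (B - M))"
    using disj by (auto simp: vertex_disjoint_def pairwise_def)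
  ultimately show ?thesis
    using p by (intro exI[of _ "p ` (B - M)"]) (auto simp: card_image B_path_def)
qed

end
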